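(* (2D divergence-free construction.) Let $\Delta x,\Delta y>0$ and let arbitrary real coefficients $\widetilde B^{1(\ell)}_{ij},\ \widetilde B^{2(\ell)}_{ij},\ A^{3(\ell)}_{ij}$ ($\ell=1,\dots,6$; $(i,j)\in\mathbb Z^2$) be given. Let $\mathbf B^h=(B^{h,1},B^{h,2})$ be the piecewise polynomial field on the Cartesian mesh $\{\mathcal T_{ij}\}$ obtained from these data by the 2D divergence-free construction defined in the context. Then: (1) on every element $\mathcal T_{ij}$ the pointwise divergence of $\mathbf B^h$ is constant and equal to $$\nabla\cdot\mathbf B^h\big|_{\mathcal T_{ij}}=\frac{2}{\Delta x}\frac{\partial B^{h,1}}{\partial\xi}+\frac{2}{\Delta y}\frac{\partial B^{h,2}}{\partial\eta}=\frac{b^{1(1)}_{i+\frac12\,j}-b^{1(1)}_{i-\frac12\,j}}{\Delta x}+\frac{b^{2(1)}_{i\,j+\frac12}-b^{2(1)}_{i\,j-\frac12}}{\Delta y},$$ and this constant is $0$; (2) the normal component of $\mathbf B^h$ is continuous across every element edge: on every vertical edge the traces of $B^{h,1}$ from the two adjacent elements coincide (both equal the edge polynomial $b^1$), and on every horizontal edge the traces of $B^{h,2}$ from the two adjacent elements coincide (both equal the edge polynomial $b^2$). That is, $\mathbf B^h$ is globally divergence-free.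
   Context: Mesh: uniform Cartesian elements $\mathcal T_{ij}$ with centers $(x_i,y_j)$, widths $\Delta x$ and $\Delta y$, and local coordinates $(\xi,\eta)\in[-1,1]^2$ given by $x=x_i+\xi\Delta x/2$, $y=y_j+\eta\Delta y/2$. Data are indexed by $(i,j)\in\mathbb Z^2$ (on a bounded mesh, data are extended by boundary conditions, e.g. periodically). The vertical edge between $\mathcal T_{i-1\,j}$ and $\mathcal T_{ij}$ has index $(i-\frac12,j)$; the horizontal edge between $\mathcal T_{i\,j-1}$ and $\mathcal T_{ij}$ has index $(i,j-\frac12)$. 2D basis $\varphi^{(\ell)}(\xi,\eta)$: $\varphi^{(1)}=1$, $\varphi^{(2)}=\sqrt3\,\xi$, $\varphi^{(3)}=\sqrt3\,\eta$, $\varphi^{(4)}=3\xi\eta$, $\varphi^{(5)}=\frac{\sqrt5}{2}(3\xi^2-1)$, $\varphi^{(6)}=\frac{\sqrt5}{2}(3\eta^2-1)$, $\varphi^{(7)}=\frac{\sqrt{15}}{2}\eta(3\xi^2-1)$, $\varphi^{(8)}=\frac{\sqrt{15}}{2}\xi(3\eta^2-1)$, $\varphi^{(9)}=\frac{\sqrt7}{2}(5\xi^3-3\xi)$, $\varphi^{(10)}=\frac{\sqrt7}{2}(5\eta^3-3\eta)$. 1D basis: $\varphi_{1D}^{(1)}(\alpha)=1$, $\varphi_{1D}^{(2)}(\alpha)=\sqrt3\,\alpha$, $\varphi_{1D}^{(3)}(\alpha)=\frac{\sqrt5}{2}(3\alpha^2-1)$. The input is the predicted magnetic field with components $\sum_{\ell=1}^6\widetilde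 B^{m(\ell)}_{ij}\varphi^{(\ell)}$ ($m=1,2$) and the magnetic potential $\sum_{\ell=1}^6A^{3(\ell)}_{ij}\varphi^{(\ell)}$ on $\mathcal T_{ij}$. Construction. Step 1 (corner potentials): $$\mathcal A^3_{i-\frac12\,j-\frac12}=\frac14\sum_{\ell=1}^6\big[A^{3(\ell)}_{ij}\varphi^{(\ell)}(-1,-1)+A^{3(\ell)}_{i\,j-1}\varphi^{(\ell)}(-1,1)+A^{3(\ell)}_{i-1\,j}\varphi^{(\ell)}(1,-1)+A^{3(\ell)}_{i-1\,j-1}\varphi^{(\ell)}(1,1)\big].$$ Step 2 (edge polynomials): $b^1_{i-\frac12\,j}(\alpha)=\sum_{\ell=1}^3b^{1(\ell)}_{i-\frac12\,j}\varphi^{(\ell)}_{1D}(\alpha)$ with $\alpha=\eta$, and $b^2_{i\,j-\frac12}(\alpha)=\sum_{\ell=1}^3b^{2(\ell)}_{i\,j-\frac12}\varphi^{(\ell)}_{1D}(\alpha)$ with $\alpha=\xi$, where $b^{1(1)}_{i-\frac12\,j}=\big(\mathcal A^3_{i-\frac12\,j+\frac12}-\mathcal A^3_{i-\frac12\,j-\frac12}\big)/\Delta y$, $\quad b^{2(1)}_{i\,j-\frac12}=\big(\mathcal A^3_{i-\frac12\,j-\frac12}-\mathcal A^3_{i+\frac12\,j-\frac12}\big)/\Delta x$, $b^{1(2)}_{i-\frac12\,j}=\frac12\big(\widetilde B^{1(3)}_{i-1\,j}+\sqrt3\,\widetilde B^{1(4)}_{i-1\,j}+\widetilde B^{1(3)}_{ij}-\sqrt3\,\widetilde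 B^{1(4)}_{ij}\big)$, $\quad b^{2(2)}_{i\,j-\frac12}=\frac12\big(\widetilde B^{2(2)}_{i\,j-1}+\sqrt3\,\widetilde B^{2(4)}_{i\,j-1}+\widetilde B^{2(2)}_{ij}-\sqrt3\,\widetilde B^{2(4)}_{ij}\big)$, $b^{1(3)}_{i-\frac12\,j}=\frac12\big(\widetilde B^{1(6)}_{i-1\,j}+\widetilde B^{1(6)}_{ij}\big)$, $\quad b^{2(3)}_{i\,j-\frac12}=\frac12\big(\widetilde B^{2(5)}_{i\,j-1}+\widetilde B^{2(5)}_{ij}\big)$. Step 3 (element field): $B^{h,m}|_{\mathcal T_{ij}}=\sum_{\ell=1}^{10}B^{m(\ell)}_{ij}\varphi^{(\ell)}(\xi,\eta)$, $m=1,2$. Fix $(i,j)$ and write $a_\pm^{(\ell)}=b^{1(\ell)}_{i\pm\frac12\,j}$, $c_\pm^{(\ell)}=b^{2(\ell)}_{i\,j\pm\frac12}$. Then $B^{1(1)}=\frac12(a_+^{(1)}+a_-^{(1)})+\frac1{2\sqrt3}\frac{\Delta x}{\Delta y}(c_+^{(2)}-c_-^{(2)})$; $B^{1(2)}=\frac1{2\sqrt3}(a_+^{(1)}-a_-^{(1)})+\frac1{2\sqrt{15}}\frac{\Delta x}{\Delta y}(c_+^{(3)}-c_-^{(3)})$; $B^{1(3)}=\frac12(a_+^{(2)}+a_-^{(2)})$; $B^{1(4)}=\frac1{2\sqrt3}(a_+^{(2)}-a_-^{(2)})$; $B^{1(5)}=\frac1{2\sqrt{15}}\frac{\Delta x}{\Delta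 y}(c_-^{(2)}-c_+^{(2)})$; $B^{1(6)}=\frac12(a_+^{(3)}+a_-^{(3)})$; $B^{1(7)}=0$; $B^{1(8)}=\frac1{2\sqrt3}(a_+^{(3)}-a_-^{(3)})$; $B^{1(9)}=\frac1{2\sqrt{35}}\frac{\Delta x}{\Delta y}(c_-^{(3)}-c_+^{(3)})$; $B^{1(10)}=0$; $B^{2(1)}=\frac12(c_+^{(1)}+c_-^{(1)})+\frac1{2\sqrt3}\frac{\Delta y}{\Delta x}(a_+^{(2)}-a_-^{(2)})$; $B^{2(2)}=\frac12(c_+^{(2)}+c_-^{(2)})$; $B^{2(3)}=\frac1{2\sqrt3}(c_+^{(1)}-c_-^{(1)})+\frac1{2\sqrt{15}}\frac{\Delta y}{\Delta x}(a_+^{(3)}-a_-^{(3)})$; $B^{2(4)}=\frac1{2\sqrt3}(c_+^{(2)}-c_-^{(2)})$; $B^{2(5)}=\frac12(c_+^{(3)}+c_-^{(3)})$; $B^{2(6)}=\frac1{2\sqrt{15}}\frac{\Delta y}{\Delta x}(a_-^{(2)}-a_+^{(2)})$; $B^{2(7)}=\frac1{2\sqrt3}(c_+^{(3)}-c_-^{(3)})$; $B^{2(8)}=B^{2(9)}=0$; $B^{2(10)}=\frac1{2\sqrt{35}}\frac{\Delta y}{\Delta x}(a_-^{(3)}-a_+^{(3)})$. *)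

theory Defs
  imports "HOL-Analysis.Analysis"
begin

text \<open>
  Coefficient arrays are indexed by the element \<open>(i, j)\<close> and the basis index \<open>\<ell>\<close>, counted from 1.
  Lists are 0-based, hence the \<open>! (l - 1)\<close>; only indices within their length are ever used.
  Half-integer indices are shifted up: vertical edge \<open>(i - 1/2, j)\<close>, horizontal edge
  \<open>(i, j - 1/2)\<close> and corner \<open>(i - 1/2, j - 1/2)\<close> are all addressed by \<open>i j\<close>.
\<close>

type_synonym coeffs = "int \<Rightarrow> int \<Rightarrow> nat \<Rightarrow> real"

definition phi :: "nat \<Rightarrow> real \<Rightarrow> real \<Rightarrow> real" where
  "phi l \<xi> \<eta> =
    [1,
     sqrt 3 * \<xi>,
     sqrt 3 * \<eta>,
     3 * \<xi> * \<eta>,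
     sqrt 5 / 2 * (3 * \<xi>^2 - 1),
     sqrt 5 / 2 * (3 * \<eta>^2 - 1),
     sqrt 15 / 2 * \<eta> * (3 * \<xi>^2 - 1),
     sqrt 15 / 2 * \<xi> * (3 * \<eta>^2 - 1),
     sqrt 7 / 2 * (5 * \<xi>^3 - 3 * \<xi>),
     sqrt 7 / 2 * (5 * \<eta>^3 - 3 * \<eta>)] ! (l - 1)"

definition phi1D :: "nat \<Rightarrow> real \<Rightarrow> real" where
  "phi1D l \<alpha> = [1, sqrt 3 * \<alpha>, sqrt 5 / 2 * (3 * \<alpha>^2 - 1)] ! (l - 1)"

definition center :: "real \<Rightarrow> real \<Rightarrow> int \<Rightarrow> real" where
  "center z0 h k = z0 + of_int k * h"

definition local_coord :: "real \<Rightarrow> real \<Rightarrow> int \<Rightarrow> real \<Rightarrow> real" where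
  "local_coord z0 h k z = (z - center z0 h k) / (h / 2)"

definition side :: "real \<Rightarrow> real \<Rightarrow> int \<Rightarrow> real set" where
  "side z0 h k = {center z0 h k - h / 2 .. center z0 h k + h / 2}"

definition element :: "real \<Rightarrow> real \<Rightarrow> real \<Rightarrow> real \<Rightarrow> int \<Rightarrow> int \<Rightarrow> (real \<times> real) set" where
  "element x0 y0 dx dy i j = side x0 dx i \<times> side y0 dy j"

definition vertical_edge :: "real \<Rightarrow> real \<Rightarrow> real \<Rightarrow> real \<Rightarrow> int \<Rightarrow> int \<Rightarrow> (real \<times> real) set" where
  "vertical_edge x0 y0 dx dy i j = {center x0 dx i - dx / 2} \<times> side y0 dy j"

definition horizontal_edge :: "real \<Rightarrow> real \<Rightarrow> real \<Rightarrow> real \<Rightarrow> int \<Rightarrow> int \<Rightarrow> (real \<times> real) set" where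
  "horizontal_edge x0 y0 dx dy i j = side x0 dx i \<times> {center y0 dy j - dy / 2}"

definition corner_potential :: "coeffs \<Rightarrow> int \<Rightarrow> int \<Rightarrow> real" where
  "corner_potential A i j =
    1 / 4 * (\<Sum>l = 1..6. A i j l * phi l (-1) (-1) + A i (j - 1) l * phi l (-1) 1
       + A (i - 1) j l * phi l 1 (-1) + A (i - 1) (j - 1) l * phi l 1 1)"

definition edge_coeff1 :: "real \<Rightarrow> coeffs \<Rightarrow> coeffs \<Rightarrow> coeffs" where
  "edge_coeff1 dy Bt1 A i j l =
    [(corner_potential A i (j + 1) - corner_potential A i j) / dy,
     1 / 2 * (Bt1 (i - 1) j 3 + sqrt 3 * Bt1 (i - 1) j 4 + Bt1 i j 3 - sqrt 3 * Bt1 i j 4),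
     1 / 2 * (Bt1 (i - 1) j 6 + Bt1 i j 6)] ! (l - 1)"

definition edge_coeff2 :: "real \<Rightarrow> coeffs \<Rightarrow> coeffs \<Rightarrow> coeffs" where
  "edge_coeff2 dx Bt2 A i j l =
    [(corner_potential A i j - corner_potential A (i + 1) j) / dx,
     1 / 2 * (Bt2 i (j - 1) 2 + sqrt 3 * Bt2 i (j - 1) 4 + Bt2 i j 2 - sqrt 3 * Bt2 i j 4),
     1 / 2 * (Bt2 i (j - 1) 5 + Bt2 i j 5)] ! (l - 1)"

definition edge_poly1 :: "real \<Rightarrow> coeffs \<Rightarrow> coeffs \<Rightarrow> int \<Rightarrow> int \<Rightarrow> real \<Rightarrow> real" where
  "edge_poly1 dy Bt1 A i j \<alpha> = (\<Sum>l = 1..3. edge_coeff1 dy Bt1 A i j l * phi1D l \<alpha>)"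

definition edge_poly2 :: "real \<Rightarrow> coeffs \<Rightarrow> coeffs \<Rightarrow> int \<Rightarrow> int \<Rightarrow> real \<Rightarrow> real" where
  "edge_poly2 dx Bt2 A i j \<alpha> = (\<Sum>l = 1..3. edge_coeff2 dx Bt2 A i j l * phi1D l \<alpha>)"

definition B1_coeff :: "real \<Rightarrow> real \<Rightarrow> coeffs \<Rightarrow> coeffs \<Rightarrow> coeffs \<Rightarrow> coeffs" where
  "B1_coeff dx dy Bt1 Bt2 A i j l =
    (let ap = edge_coeff1 dy Bt1 A (i + 1) j; am = edge_coeff1 dy Bt1 A i j;
         cp = edge_coeff2 dx Bt2 A i (j + 1); cm = edge_coeff2 dx Bt2 A i j
     in [1 / 2 * (ap 1 + am 1) + 1 / (2 * sqrt 3) * (dx / dy) * (cp 2 - cm 2),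
         1 / (2 * sqrt 3) * (ap 1 - am 1) + 1 / (2 * sqrt 15) * (dx / dy) * (cp 3 - cm 3),
         1 / 2 * (ap 2 + am 2),
         1 / (2 * sqrt 3) * (ap 2 - am 2),
         1 / (2 * sqrt 15) * (dx / dy) * (cm 2 - cp 2),
         1 / 2 * (ap 3 + am 3),
         0,
         1 / (2 * sqrt 3) * (ap 3 - am 3),
         1 / (2 * sqrt 35) * (dx / dy) * (cm 3 - cp 3),
         0] ! (l - 1))"

definition B2_coeff :: "real \<Rightarrow> real \<Rightarrow> coeffs \<Rightarrow> coeffs \<Rightarrow> coeffs \<Rightarrow> coeffs" where
  "B2_coeff dx dy Bt1 Bt2 A i j l =
    (let ap = edge_coeff1 dy Bt1 A (i + 1) j; am = edge_coeff1 dy Bt1 A i j;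
         cp = edge_coeff2 dx Bt2 A i (j + 1); cm = edge_coeff2 dx Bt2 A i j
     in [1 / 2 * (cp 1 + cm 1) + 1 / (2 * sqrt 3) * (dy / dx) * (ap 2 - am 2),
         1 / 2 * (cp 2 + cm 2),
         1 / (2 * sqrt 3) * (cp 1 - cm 1) + 1 / (2 * sqrt 15) * (dy / dx) * (ap 3 - am 3),
         1 / (2 * sqrt 3) * (cp 2 - cm 2),
         1 / 2 * (cp 3 + cm 3),
         1 / (2 * sqrt 15) * (dy / dx) * (am 2 - ap 2),
         1 / (2 * sqrt 3) * (cp 3 - cm 3),
         0,
         0,
         1 / (2 * sqrt 35) * (dy / dx) * (am 3 - ap 3)] ! (l - 1))"

definition B1_local :: "real \<Rightarrow> real \<Rightarrow> coeffs \<Rightarrow> coeffs \<Rightarrow> coeffs \<Rightarrow> int \<Rightarrow> int \<Rightarrow> real \<Rightarrow> real \<Rightarrow> real" where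
  "B1_local dx dy Bt1 Bt2 A i j \<xi> \<eta> =
    (\<Sum>l = 1..10. B1_coeff dx dy Bt1 Bt2 A i j l * phi l \<xi> \<eta>)"

definition B2_local :: "real \<Rightarrow> real \<Rightarrow> coeffs \<Rightarrow> coeffs \<Rightarrow> coeffs \<Rightarrow> int \<Rightarrow> int \<Rightarrow> real \<Rightarrow> real \<Rightarrow> real" where
  "B2_local dx dy Bt1 Bt2 A i j \<xi> \<eta> =
    (\<Sum>l = 1..10. B2_coeff dx dy Bt1 Bt2 A i j l * phi l \<xi> \<eta>)"

text \<open>
  The restriction of the piecewise polynomial field to the closed element \<open>(i, j)\<close>, in physical
  coordinates. It is the polynomial itself, so that its values on the element boundary are the
  traces from that element and its partial derivatives make sense up to the boundary.
\<close>

definition B_field ::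
  "real \<Rightarrow> real \<Rightarrow> real \<Rightarrow> real \<Rightarrow> coeffs \<Rightarrow> coeffs \<Rightarrow> coeffs \<Rightarrow> int \<Rightarrow> int \<Rightarrow> real \<times> real \<Rightarrow> real \<times> real" where
  "B_field x0 y0 dx dy Bt1 Bt2 A i j = (\<lambda>(x, y).
    (B1_local dx dy Bt1 Bt2 A i j (local_coord x0 dx i x) (local_coord y0 dy j y),
     B2_local dx dy Bt1 Bt2 A i j (local_coord x0 dx i x) (local_coord y0 dy j y)))"

definition divergence2 :: "(real \<times> real \<Rightarrow> real \<times> real) \<Rightarrow> real \<times> real \<Rightarrow> real" where
  "divergence2 F = (\<lambda>(x, y). deriv (\<lambda>s. fst (F (s, y))) x + deriv (\<lambda>s. snd (F (x, s))) y)"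

end

theory Submission imports Defs
begin

text \<open>
  Written out in the given basis, the element field hides a simple shape. In the first component,
  everything that depends on \<open>\<eta>\<close> is the linear interpolation in \<open>\<xi>\<close> between the two vertical edge
  polynomials; what remains is \<open>dx / (2 dy)\<close> times a polynomial in \<open>\<xi>\<close> alone, which vanishes at
  \<open>\<xi> = -1\<close> and \<open>\<xi> = 1\<close> and whose derivative is minus the non-constant part of the jump of
  \<open>b\<^sup>2\<close> across the element (lemma \<open>B1_local_interpolation\<close>). The second component is the same with
  the axes exchanged.

  Both claims are read off from this form. The bubble vanishes on the edges, so the normal traces
  are the edge polynomials, which belong to the edge and not to an element. In the divergence,
  \<open>\<partial>B\<^sup>1/\<partial>x\<close> contributes the full jump of \<open>b\<^sup>1\<close> over \<open>dx\<close> (a function of \<open>\<eta>\<close>) minus the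
  non-constant part of the jump of \<open>b\<^sup>2\<close> over \<open>dy\<close> (a function of \<open>\<xi>\<close>), and \<open>\<partial>B\<^sup>2/\<partial>y\<close>
  contributes the opposite combination; only the jumps of the edge means survive. These means are
  differences of corner potentials along the edges, so their sum is a discrete divergence of a
  discrete curl and telescopes around the element to zero.
\<close>

section \<open>Edge polynomials and bubbles\<close>

text \<open>
  The polynomial vanishing at both endpoints whose derivative is
  \<open>- p \<phi>\<^sup>(\<^sup>2\<^sup>)\<^sub>1\<^sub>D - q \<phi>\<^sup>(\<^sup>3\<^sup>)\<^sub>1\<^sub>D\<close>. It exists because these two Legendre polynomials have mean
  zero on \<open>[-1, 1]\<close>.
\<close>
definition bubble :: "real \<Rightarrow> real \<Rightarrow> real \<Rightarrow> real" where
  "bubble p q s = sqrt 3 / 2 * p * (1 - s^2) + sqrt 5 / 2 * q * (s - s^3)"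

lemma bubble_endpoints [simp]: "bubble p q 1 = 0" "bubble p q (-1) = 0"
  by (simp_all add: bubble_def)

lemma bubble_deriv:
  "(bubble p q has_field_derivative - (p * phi1D 2 s + q * phi1D 3 s)) (at s)"
  unfolding bubble_def[abs_def]
  by (auto intro!: derivative_eq_intros simp: phi1D_def field_simps power2_eq_square)

lemma bubble_differentiable:
  fixes g :: "real \<times> real \<Rightarrow> real"
  assumes "g differentiable (at z)"
  shows "(\<lambda>u. bubble p q (g u)) differentiable (at z)"
  unfolding bubble_def using assms by (auto intro!: derivative_intros)

lemma sum_to_3: "(\<Sum>l = 1..3. f l) = f 1 + f 2 + f (3::nat)" for f :: "nat \<Rightarrow> real"
  by (simp add: numeral_eq_Suc)

lemma sum_to_10:
  "(\<Sum>l = 1..10. f l) = f 1 + f 2 + f 3 + f 4 + f 5 + f 6 + f 7 + f 8 + f 9 + f (10::nat)"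
  for f :: "nat \<Rightarrow> real"
  by (simp add: numeral_eq_Suc)

lemma edge_poly1_expand:
  "edge_poly1 dy Bt1 A i j s = edge_coeff1 dy Bt1 A i j 1
     + edge_coeff1 dy Bt1 A i j 2 * phi1D 2 s + edge_coeff1 dy Bt1 A i j 3 * phi1D 3 s"
  unfolding edge_poly1_def sum_to_3 by (simp add: phi1D_def)

lemma edge_poly2_expand:
  "edge_poly2 dx Bt2 A i j s = edge_coeff2 dx Bt2 A i j 1
     + edge_coeff2 dx Bt2 A i j 2 * phi1D 2 s + edge_coeff2 dx Bt2 A i j 3 * phi1D 3 s"
  unfolding edge_poly2_def sum_to_3 by (simp add: phi1D_def)

lemma edge_poly1_differentiable:
  fixes g :: "real \<times> real \<Rightarrow> real"
  assumes "g differentiable (at z)"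
  shows "(\<lambda>u. edge_poly1 dy Bt1 A i j (g u)) differentiable (at z)"
  unfolding edge_poly1_expand phi1D_def using assms by (auto intro!: derivative_intros)

lemma edge_poly2_differentiable:
  fixes g :: "real \<times> real \<Rightarrow> real"
  assumes "g differentiable (at z)"
  shows "(\<lambda>u. edge_poly2 dx Bt2 A i j (g u)) differentiable (at z)"
  unfolding edge_poly2_expand phi1D_def using assms by (auto intro!: derivative_intros)

section \<open>The element field as interpolation plus bubble\<close>

text \<open>
  The constants combining \<open>\<surd>3\<close>, \<open>\<surd>5\<close> and \<open>\<surd>7\<close> in the element coefficients undo the normalisation
  of the basis: for instance the coefficients of \<open>\<phi>\<^sup>(\<^sup>1\<^sup>)\<close> and \<open>\<phi>\<^sup>(\<^sup>5\<^sup>)\<close> carry the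
  jump of \<open>b\<^sup>2\<^sup>(\<^sup>2\<^sup>)\<close> in just the ratio that yields a multiple of \<open>1 - \<xi>\<^sup>2\<close>.
\<close>
lemma B1_local_interpolation:
  "B1_local dx dy Bt1 Bt2 A i j \<xi> \<eta> =
     (1 - \<xi>) / 2 * edge_poly1 dy Bt1 A i j \<eta> + (1 + \<xi>) / 2 * edge_poly1 dy Bt1 A (i + 1) j \<eta>
     + dx / (2 * dy) * bubble (edge_coeff2 dx Bt2 A i (j + 1) 2 - edge_coeff2 dx Bt2 A i j 2)
                              (edge_coeff2 dx Bt2 A i (j + 1) 3 - edge_coeff2 dx Bt2 A i j 3) \<xi>"
proof -
  have roots: "sqrt 15 = sqrt 3 * sqrt 5" "sqrt 35 = sqrt 5 * sqrt 7"
    by (simp_all flip: real_sqrt_mult)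
  have inv: "1 / (2 * sqrt 3) = sqrt 3 / 6"
    "1 / (2 * (sqrt 3 * sqrt 5)) = sqrt 3 * sqrt 5 / 30"
    "1 / (2 * (sqrt 5 * sqrt 7)) = sqrt 5 * sqrt 7 / 70"
    by (simp_all add: field_simps)
  have sq: "sqrt 3 * (sqrt 3 * z) = 3 * z" "sqrt 5 * (sqrt 5 * z) = 5 * z"
    "sqrt 7 * (sqrt 7 * z) = 7 * z" for z
    by (simp_all flip: mult.assoc)
  show ?thesis
    unfolding B1_local_def sum_to_10 edge_poly1_expand bubble_def B1_coeff_def Let_def
      phi_def phi1D_def roots inv
    by (simp add: divide_simps) (simp add: algebra_simps power2_eq_square power3_eq_cube sq)
qed

lemma B2_local_interpolation:
  "B2_local dx dy Bt1 Bt2 A i j \<xi> \<eta> =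
     (1 - \<eta>) / 2 * edge_poly2 dx Bt2 A i j \<xi> + (1 + \<eta>) / 2 * edge_poly2 dx Bt2 A i (j + 1) \<xi>
     + dy / (2 * dx) * bubble (edge_coeff1 dy Bt1 A (i + 1) j 2 - edge_coeff1 dy Bt1 A i j 2)
                              (edge_coeff1 dy Bt1 A (i + 1) j 3 - edge_coeff1 dy Bt1 A i j 3) \<eta>"
proof -
  have roots: "sqrt 15 = sqrt 3 * sqrt 5" "sqrt 35 = sqrt 5 * sqrt 7"
    by (simp_all flip: real_sqrt_mult)
  have inv: "1 / (2 * sqrt 3) = sqrt 3 / 6"
    "1 / (2 * (sqrt 3 * sqrt 5)) = sqrt 3 * sqrt 5 / 30"
    "1 / (2 * (sqrt 5 * sqrt 7)) = sqrt 5 * sqrt 7 / 70"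
    by (simp_all add: field_simps)
  have sq: "sqrt 3 * (sqrt 3 * z) = 3 * z" "sqrt 5 * (sqrt 5 * z) = 5 * z"
    "sqrt 7 * (sqrt 7 * z) = 7 * z" for z
    by (simp_all flip: mult.assoc)
  show ?thesis
    unfolding B2_local_def sum_to_10 edge_poly2_expand bubble_def B2_coeff_def Let_def
      phi_def phi1D_def roots inv
    by (simp add: divide_simps) (simp add: algebra_simps power2_eq_square power3_eq_cube sq)
qed

section \<open>Divergence\<close>

lemma B1_local_deriv:
  assumes "dx > 0" "dy > 0"
  shows "((\<lambda>s. B1_local dx dy Bt1 Bt2 A i j s \<eta>) has_field_derivative
     (edge_poly1 dy Bt1 A (i + 1) j \<eta> - edge_poly1 dy Bt1 A i j \<eta>) / 2
     - dx / (2 * dy) * ((edge_poly2 dx Bt2 A i (j + 1) \<xi> - edge_coeff2 dx Bt2 A i (j + 1) 1)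
                        - (edge_poly2 dx Bt2 A i j \<xi> - edge_coeff2 dx Bt2 A i j 1))) (at \<xi>)"
  unfolding B1_local_interpolation using assms
  by (auto intro!: derivative_eq_intros bubble_deriv[THEN DERIV_cong])
    (simp add: edge_poly2_expand algebra_simps diff_divide_distrib)

lemma B2_local_deriv:
  assumes "dx > 0" "dy > 0"
  shows "((\<lambda>s. B2_local dx dy Bt1 Bt2 A i j \<xi> s) has_field_derivative
     (edge_poly2 dx Bt2 A i (j + 1) \<xi> - edge_poly2 dx Bt2 A i j \<xi>) / 2
     - dy / (2 * dx) * ((edge_poly1 dy Bt1 A (i + 1) j \<eta> - edge_coeff1 dy Bt1 A (i + 1) j 1)
                        - (edge_poly1 dy Bt1 A i j \<eta> - edge_coeff1 dy Bt1 A i j 1))) (at \<eta>)"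
  unfolding B2_local_interpolation using assms
  by (auto intro!: derivative_eq_intros bubble_deriv[THEN DERIV_cong])
    (simp add: edge_poly1_expand algebra_simps diff_divide_distrib)

text \<open>
  The non-constant parts of the two jumps occur once in each partial derivative, with weights that
  become opposite after scaling by \<open>2 / dx\<close> and \<open>2 / dy\<close>.
\<close>
lemma scaled_local_divergence:
  assumes "dx > 0" "dy > 0"
  shows "2 / dx * deriv (\<lambda>s. B1_local dx dy Bt1 Bt2 A i j s \<eta>) \<xi>
       + 2 / dy * deriv (\<lambda>s. B2_local dx dy Bt1 Bt2 A i j \<xi> s) \<eta>
     = (edge_coeff1 dy Bt1 A (i + 1) j 1 - edge_coeff1 dy Bt1 A i j 1) / dx
       + (edge_coeff2 dx Bt2 A i (j + 1) 1 - edge_coeff2 dx Bt2 A i j 1) / dy"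
  unfolding DERIV_imp_deriv[OF B1_local_deriv[OF assms]] DERIV_imp_deriv[OF B2_local_deriv[OF assms]]
  using assms by (simp add: field_simps)

text \<open>
  Each of the four corner potentials of an element is met by one vertical and one horizontal edge
  and enters the two mean fluxes with opposite signs.
\<close>
lemma mean_flux_balance:
  "(edge_coeff1 dy Bt1 A (i + 1) j 1 - edge_coeff1 dy Bt1 A i j 1) / dx
     + (edge_coeff2 dx Bt2 A i (j + 1) 1 - edge_coeff2 dx Bt2 A i j 1) / dy = 0"
  by (simp add: edge_coeff1_def edge_coeff2_def diff_divide_distrib mult.commute)

lemma local_coord_deriv:
  assumes "h > 0"
  shows "(local_coord z0 h k has_field_derivative 2 / h) (at z)"
  unfolding local_coord_def[abs_def] using assms
  by (auto intro!: derivative_eq_intros)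

lemma divergence2_B_field:
  assumes "dx > 0" "dy > 0"
  shows "divergence2 (B_field x0 y0 dx dy Bt1 Bt2 A i j) (x, y) =
     2 / dx * deriv (\<lambda>s. B1_local dx dy Bt1 Bt2 A i j s (local_coord y0 dy j y)) (local_coord x0 dx i x)
     + 2 / dy * deriv (\<lambda>s. B2_local dx dy Bt1 Bt2 A i j (local_coord x0 dx i x) s) (local_coord y0 dy j y)"
proof -
  have "deriv (\<lambda>s. fst (B_field x0 y0 dx dy Bt1 Bt2 A i j (s, y))) x =
      deriv (\<lambda>s. B1_local dx dy Bt1 Bt2 A i j s (local_coord y0 dy j y)) (local_coord x0 dx i x) * (2 / dx)"
    unfolding DERIV_imp_deriv[OF B1_local_deriv[OF assms]]
    using DERIV_chain2[OF B1_local_deriv[OF assms] local_coord_deriv[OF assms(1)]]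
    by (intro DERIV_imp_deriv) (simp add: B_field_def)
  moreover have "deriv (\<lambda>s. snd (B_field x0 y0 dx dy Bt1 Bt2 A i j (x, s))) y =
      deriv (\<lambda>s. B2_local dx dy Bt1 Bt2 A i j (local_coord x0 dx i x) s) (local_coord y0 dy j y) * (2 / dy)"
    unfolding DERIV_imp_deriv[OF B2_local_deriv[OF assms]]
    using DERIV_chain2[OF B2_local_deriv[OF assms] local_coord_deriv[OF assms(2)]]
    by (intro DERIV_imp_deriv) (simp add: B_field_def)
  ultimately show ?thesis
    by (simp add: divergence2_def mult.commute)
qed

lemma B_field_differentiable:
  assumes "dx > 0" "dy > 0"
  shows "B_field x0 y0 dx dy Bt1 Bt2 A i j differentiable (at z)"
proof -
  have lin: "fst differentiable (at z)" "snd differentiable (at z)" for z :: "real \<times> real"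
    by (simp_all add: bounded_linear_imp_differentiable bounded_linear_fst bounded_linear_snd)
  have loc: "(\<lambda>u::real \<times> real. local_coord x0 dx i (fst u)) differentiable (at z)"
    "(\<lambda>u::real \<times> real. local_coord y0 dy j (snd u)) differentiable (at z)"
    unfolding local_coord_def using assms lin by (auto intro!: derivative_intros)
  have "(\<lambda>u. (B1_local dx dy Bt1 Bt2 A i j (local_coord x0 dx i (fst u)) (local_coord y0 dy j (snd u)),
              B2_local dx dy Bt1 Bt2 A i j (local_coord x0 dx i (fst u)) (local_coord y0 dy j (snd u))))
        differentiable (at z)"
    unfolding B1_local_interpolation B2_local_interpolation
    using loc assms by (auto intro!: differentiable_Pair derivative_intros bubble_differentiable
        edge_poly1_differentiable edge_poly2_differentiable)
  then show ?thesis
    by (simp add: B_field_def case_prod_unfold)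
qed

section \<open>Normal traces\<close>

text \<open>
  An edge stored under the index \<open>k\<close> is the lower boundary of cell \<open>k\<close> and the upper boundary of
  cell \<open>k - 1\<close>.
\<close>
lemma local_coord_edge:
  assumes "h > 0"
  shows "local_coord z0 h k (center z0 h k - h / 2) = -1"
    and "local_coord z0 h (k - 1) (center z0 h k - h / 2) = 1"
  using assms by (simp_all add: local_coord_def center_def field_simps)

theorem mainTheorem1:
  fixes x0 y0 dx dy :: real and Bt1 Bt2 A3 :: "int \<Rightarrow> int \<Rightarrow> nat \<Rightarrow> real"
  assumes "dx > 0" and "dy > 0"
  defines "B \<equiv> B_field x0 y0 dx dy Bt1 Bt2 A3"
    and "B1 \<equiv> B1_local dx dy Bt1 Bt2 A3"
    and "B2 \<equiv> B2_local dx dy Bt1 Bt2 A3"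
    and "b1 \<equiv> edge_coeff1 dy Bt1 A3"
    and "b2 \<equiv> edge_coeff2 dx Bt2 A3"
  shows
    "(\<forall>i j x y. (x, y) \<in> element x0 y0 dx dy i j \<longrightarrow>
        (let \<xi> = local_coord x0 dx i x; \<eta> = local_coord y0 dy j y in
          B i j differentiable (at (x, y)) \<and>
          divergence2 (B i j) (x, y)
            = 2 / dx * deriv (\<lambda>s. B1 i j s \<eta>) \<xi> + 2 / dy * deriv (\<lambda>s. B2 i j \<xi> s) \<eta> \<and>
          divergence2 (B i j) (x, y)
            = (b1 (i + 1) j 1 - b1 i j 1) / dx + (b2 i (j + 1) 1 - b2 i j 1) / dy \<and>
          (b1 (i + 1) j 1 - b1 i j 1) / dx + (b2 i (j + 1) 1 - b2 i j 1) / dy = 0))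
     \<and> (\<forall>i j x y. (x, y) \<in> vertical_edge x0 y0 dx dy i j \<longrightarrow>
          fst (B (i - 1) j (x, y)) = edge_poly1 dy Bt1 A3 i j (local_coord y0 dy j y) \<and>
          fst (B i j (x, y)) = edge_poly1 dy Bt1 A3 i j (local_coord y0 dy j y))
     \<and> (\<forall>i j x y. (x, y) \<in> horizontal_edge x0 y0 dx dy i j \<longrightarrow>
          snd (B i (j - 1) (x, y)) = edge_poly2 dx Bt2 A3 i j (local_coord x0 dx i x) \<and>
          snd (B i j (x, y)) = edge_poly2 dx Bt2 A3 i j (local_coord x0 dx i x))"
proof (intro conjI allI impI)
  fix i j x y
  show "let \<xi> = local_coord x0 dx i x; \<eta> = local_coord y0 dy j y in
      B i j differentiable (at (x, y)) \<and>
      divergence2 (B i j) (x, y)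
        = 2 / dx * deriv (\<lambda>s. B1 i j s \<eta>) \<xi> + 2 / dy * deriv (\<lambda>s. B2 i j \<xi> s) \<eta> \<and>
      divergence2 (B i j) (x, y)
        = (b1 (i + 1) j 1 - b1 i j 1) / dx + (b2 i (j + 1) 1 - b2 i j 1) / dy \<and>
      (b1 (i + 1) j 1 - b1 i j 1) / dx + (b2 i (j + 1) 1 - b2 i j 1) / dy = 0"
    unfolding Let_def B_def B1_def B2_def b1_def b2_def
    by (intro conjI B_field_differentiable divergence2_B_field mean_flux_balance assms(1,2)
        trans[OF divergence2_B_field scaled_local_divergence])
next
  fix i j x y
  assume "(x, y) \<in> vertical_edge x0 y0 dx dy i j"
  then have x: "x = center x0 dx i - dx / 2"
    by (simp add: vertical_edge_def)
  show "fst (B (i - 1) j (x, y)) = edge_poly1 dy Bt1 A3 i j (local_coord y0 dy j y)"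
    "fst (B i j (x, y)) = edge_poly1 dy Bt1 A3 i j (local_coord y0 dy j y)"
    using assms(1) unfolding B_def x
    by (simp_all add: B_field_def local_coord_edge B1_local_interpolation)
next
  fix i j x y
  assume "(x, y) \<in> horizontal_edge x0 y0 dx dy i j"
  then have y: "y = center y0 dy j - dy / 2"
    by (simp add: horizontal_edge_def)
  show "snd (B i (j - 1) (x, y)) = edge_poly2 dx Bt2 A3 i j (local_coord x0 dx i x)"
    "snd (B i j (x, y)) = edge_poly2 dx Bt2 A3 i j (local_coord x0 dx i x)"
    using assms(2) unfolding B_def y
    by (simp_all add: B_field_def local_coord_edge B2_local_interpolation)
qed

end
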